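(* Let $(f,\bar{f}) \colon (G,P_G) \rightarrow (H,P_H)$ be a morphism in $\mathsf{PreOrdGrp}$. Then a $\mathscr{Z}$-kernel of $(f,\bar{f})$ is given by the morphism $$(k,\bar{k}) \colon (G,P_G \cap \mathsf{Ker}(f)) \rightarrow (G,P_G)$$ where $k$ is the identity morphism $1_G$ (and $\bar k$ is the inclusion). Moreover, $P_G \cap \mathsf{Ker}(f) = \mathsf{Ker}(\bar{f})$, the kernel of $\bar f$ in the category of monoids.
   Context: Groups and monoids are written additively but need not be commutative. $\mathsf{PreOrdGrp}$ is the category of preordered groups: objects are pairs $(G,P_G)$ with $G$ a group and $P_G$ a submonoid of $G$ closed under conjugation in $G$ (the positive cone); a morphism $(f,\bar f)\colon (G,P_G)\to(H,P_H)$ is a group morphism $f\colon G\to H$ with $f(P_G)\subseteq P_H$, and $\bar f\colon P_G\to P_H$ is its restriction. $\mathscr{Z}$ is the class of preordered groups $(G,P_G)$ with $P_G=0$. A morphism is $\mathscr{Z}$-trivial if it factors through an object of $\mathscr{Z}$. A morphism $k\colon K\to C$ is a $\mathscr{Z}$-kernel of $q\colon C\to D$ if $q\cdot k$ is $\mathscr{Z}$-trivial and, for every $\alpha\colon X\to C$ such that $q\cdot\alpha$ is $\mathscr{Z}$-trivial, there is a unique $\phi\colon X\to K$ with $k\cdot\phi=\alpha$. *)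

theory Defs
  imports "HOL-Algebra.Coset"
begin

text \<open>Groups and monoids follow HOL-Algebra: they are written multiplicatively and need not be
commutative, so the trivial cone \<open>0\<close> reads \<open>{\<one>}\<close>.\<close>

record 'a preord_group = "'a monoid" +
  pos_cone :: "'a set"

locale preordered_group = group G
  for G :: "'a preord_group" (structure) +
  assumes cone_submonoid: "submonoid (pos_cone G) G"
    and cone_conj_closed:
      "\<lbrakk>g \<in> carrier G; p \<in> pos_cone G\<rbrakk> \<Longrightarrow> g \<otimes> p \<otimes> inv g \<in> pos_cone G"

text \<open>Morphisms are functions extensional on the carrier, so that equality of morphisms is equality
in HOL, and composition is \<^const>\<open>compose\<close> on the carrier of the source.\<close>

definition preord_hom :: "'a preord_group \<Rightarrow> 'b preord_group \<Rightarrow> ('a \<Rightarrow> 'b) set" where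
  "preord_hom G H =
     {f \<in> hom G H. f \<in> extensional (carrier G) \<and> f ` pos_cone G \<subseteq> pos_cone H}"

definition cone_monoid :: "'a preord_group \<Rightarrow> 'a monoid" where
  "cone_monoid G = \<lparr>carrier = pos_cone G, mult = mult G, one = one G\<rparr>"

definition cone_map :: "'a preord_group \<Rightarrow> ('a \<Rightarrow> 'b) \<Rightarrow> 'a \<Rightarrow> 'b" where
  "cone_map G f = restrict f (pos_cone G)"

definition Z_object :: "'a preord_group \<Rightarrow> bool" where
  "Z_object G \<longleftrightarrow> preordered_group G \<and> pos_cone G = {\<one>\<^bsub>G\<^esub>}"

definition factors_through ::
  "'a preord_group \<Rightarrow> 'b preord_group \<Rightarrow> ('a \<Rightarrow> 'b) \<Rightarrow> 'z preord_group \<Rightarrow> bool" where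
  "factors_through G H f Z \<longleftrightarrow>
     (\<exists>h \<in> preord_hom G Z. \<exists>g \<in> preord_hom Z H. f = compose (carrier G) g h)"

text \<open>HOL cannot quantify over types inside a formula, so the intermediate object ranges over
preordered groups on the element type of the codomain. By \<open>Z_trivial_if_factors\<close> below, this is no
restriction: an intermediate object on any other type yields one on that type.\<close>

definition Z_trivial :: "'a preord_group \<Rightarrow> 'b preord_group \<Rightarrow> ('a \<Rightarrow> 'b) \<Rightarrow> bool" where
  "Z_trivial G H f \<longleftrightarrow> (\<exists>Z :: 'b preord_group. Z_object Z \<and> factors_through G H f Z)"

lemma Z_trivial_if_factors:
  fixes G :: "'a preord_group" and H :: "'b preord_group" and Z :: "'z preord_group"
  assumes "preordered_group G" "preordered_group H" "Z_object Z" "factors_through G H f Z"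
  shows "Z_trivial G H f"
proof -
  interpret G: preordered_group G by fact
  interpret H: preordered_group H by fact
  interpret Z: preordered_group Z using assms(3) by (simp add: Z_object_def)
  obtain h g where h: "h \<in> preord_hom G Z" and g: "g \<in> preord_hom Z H"
    and f: "f = compose (carrier G) g h"
    using assms(4) by (auto simp: factors_through_def)
  have Zc: "pos_cone Z = {\<one>\<^bsub>Z\<^esub>}"
    using assms(3) by (simp add: Z_object_def)
  have coneG: "pos_cone G \<subseteq> carrier G"
    using G.cone_submonoid by (rule submonoid.subset)
  have homh: "h \<in> hom G Z" and homg: "g \<in> hom Z H"
    using h g by (simp_all add: preord_hom_def)
  have g1: "g \<one>\<^bsub>Z\<^esub> = \<one>\<^bsub>H\<^esub>"
    using homg by (rule hom_one) unfold_locales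
  have homf: "f \<in> hom G H"
    using homh homg unfolding f hom_def compose_def by (auto simp: Pi_iff)
  have f1: "f ` pos_cone G \<subseteq> {\<one>\<^bsub>H\<^esub>}"
    using h Zc g1 coneG by (auto simp: preord_hom_def f compose_def)
  define Z' where "Z' = H\<lparr>pos_cone := {\<one>\<^bsub>H\<^esub>}\<rparr>"
  have sel: "carrier Z' = carrier H" "mult Z' = mult H" "one Z' = one H"
    "pos_cone Z' = {\<one>\<^bsub>H\<^esub>}"
    by (simp_all add: Z'_def)
  have inv: "inv\<^bsub>Z'\<^esub> x = inv\<^bsub>H\<^esub> x" for x
    by (simp add: m_inv_def sel)
  have "group Z'"
    using H.l_inv_ex by (intro groupI) (auto simp: sel H.m_assoc)
  then have "preordered_group Z'"
    unfolding preordered_group_def preordered_group_axioms_def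
    by (auto simp: sel inv intro!: submonoid.intro)
  then have "Z_object Z'"
    by (simp add: Z_object_def sel)
  moreover have "f \<in> preord_hom G Z'"
    using homf f1 by (auto simp: preord_hom_def hom_def sel f compose_def)
  moreover have "(\<lambda>x\<in>carrier H. x) \<in> preord_hom Z' H"
    using submonoid.one_closed[OF H.cone_submonoid]
    by (auto simp: preord_hom_def hom_def sel)
  moreover have "f = compose (carrier G) (\<lambda>x\<in>carrier H. x) f"
  proof
    fix x
    show "f x = compose (carrier G) (\<lambda>x\<in>carrier H. x) f x"
      using hom_in_carrier[OF homf, of x]
      by (cases "x \<in> carrier G") (simp_all add: f compose_def)
  qed
  ultimately show ?thesis
    unfolding Z_trivial_def factors_through_def by blast
qed

text \<open>The type argument is the element type of the test objects \<open>X\<close>; a statement that leaves it as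
a type variable covers all of them.\<close>

definition is_Z_kernel ::
  "'x itself \<Rightarrow> 'k preord_group \<Rightarrow> 'c preord_group \<Rightarrow> 'd preord_group
    \<Rightarrow> ('k \<Rightarrow> 'c) \<Rightarrow> ('c \<Rightarrow> 'd) \<Rightarrow> bool" where
  "is_Z_kernel _ K C D k q \<longleftrightarrow>
     preordered_group K \<and> k \<in> preord_hom K C \<and>
     Z_trivial K D (compose (carrier K) q k) \<and>
     (\<forall>X :: 'x preord_group. \<forall>\<alpha> \<in> preord_hom X C.
        preordered_group X \<longrightarrow> Z_trivial X D (compose (carrier X) q \<alpha>) \<longrightarrow>
        (\<exists>!\<phi>. \<phi> \<in> preord_hom X K \<and> compose (carrier X) k \<phi> = \<alpha>))"

definition monoid_hom :: "'a monoid \<Rightarrow> 'b monoid \<Rightarrow> ('a \<Rightarrow> 'b) set" where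
  "monoid_hom M N =
     {f \<in> hom M N. f \<in> extensional (carrier M) \<and> f \<one>\<^bsub>M\<^esub> = \<one>\<^bsub>N\<^esub>}"

definition zero_hom :: "'a monoid \<Rightarrow> 'b monoid \<Rightarrow> 'a \<Rightarrow> 'b" where
  "zero_hom M N = (\<lambda>x\<in>carrier M. \<one>\<^bsub>N\<^esub>)"

definition is_monoid_kernel ::
  "'x itself \<Rightarrow> 'k monoid \<Rightarrow> 'c monoid \<Rightarrow> 'd monoid
    \<Rightarrow> ('k \<Rightarrow> 'c) \<Rightarrow> ('c \<Rightarrow> 'd) \<Rightarrow> bool" where
  "is_monoid_kernel _ K C D k q \<longleftrightarrow>
     monoid K \<and> k \<in> monoid_hom K C \<and>
     compose (carrier K) q k = zero_hom K D \<and>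
     (\<forall>X :: 'x monoid. \<forall>\<alpha> \<in> monoid_hom X C.
        monoid X \<longrightarrow> compose (carrier X) q \<alpha> = zero_hom X D \<longrightarrow>
        (\<exists>!\<phi>. \<phi> \<in> monoid_hom X K \<and> compose (carrier X) k \<phi> = \<alpha>))"

end

theory Submission
  imports Defs
begin

text \<open>A morphism of preordered groups is trivial precisely when it sends the positive cone to the
neutral element. Hence a morphism into \<open>G\<close> becomes trivial after composition with \<open>f\<close> precisely when
it sends the cone into \<open>kernel G H f\<close>, that is, when the same map is a morphism into \<open>G\<close> with the
cone cut down to that kernel.\<close>

text \<open>Both objects constructed below, the intermediate one for a trivial morphism and the
  domain of the \<Z>-kernel, arise by changing only the cone, so the group laws and inverses carry
  over unchanged.\<close>

lemma preordered_group_pos_cone_update: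
  fixes G :: "'a preord_group" (structure)
  assumes "group G" and P: "submonoid P G"
    and conj: "\<And>g p. g \<in> carrier G \<Longrightarrow> p \<in> P \<Longrightarrow> g \<otimes> p \<otimes> inv g \<in> P"
  shows "preordered_group (G\<lparr>pos_cone := P\<rparr>)"
proof -
  interpret group G by fact
  let ?G = "G\<lparr>pos_cone := P\<rparr>"
  have "inv\<^bsub>?G\<^esub> x = inv x" for x
    by (simp add: m_inv_def)
  moreover have "group ?G"
    using l_inv_ex by (intro groupI) (auto simp: m_assoc)
  ultimately show ?thesis
    using P conj
    by (auto simp: preordered_group_def preordered_group_axioms_def submonoid_def)
qed

lemma preord_hom_pos_cone_update:
  assumes "P \<subseteq> pos_cone G"
  shows "\<phi> \<in> preord_hom X (G\<lparr>pos_cone := P\<rparr>) \<longleftrightarrow> \<phi> \<in> preord_hom X G \<and> \<phi> ` pos_cone X \<subseteq> P"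
proof -
  have "hom X (G\<lparr>pos_cone := P\<rparr>) = hom X G"
    by (simp add: hom_def)
  then show ?thesis
    using assms unfolding preord_hom_def by auto
qed

text \<open>This map serves twice: as the second factor of a trivial morphism and as the \<Z>-kernel
  itself.\<close>

lemma preord_hom_Id_pos_cone_update:
  assumes "group G" and "P \<subseteq> pos_cone G" and "P \<subseteq> carrier G"
  shows "(\<lambda>x\<in>carrier G. x) \<in> preord_hom (G\<lparr>pos_cone := P\<rparr>) G"
proof -
  interpret group G by fact
  show ?thesis
    using assms(2,3) by (auto simp: preord_hom_def hom_def)
qed

lemma preord_hom_compose:
  assumes "f \<in> preord_hom G H" and "g \<in> preord_hom H K"
    and "preordered_group G"
  shows "compose (carrier G) g f \<in> preord_hom G K"
proof -
  interpret G: preordered_group G by fact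
  \<comment> \<open>\<open>compose\<close> is \<open>undefined\<close> off the carrier, so its
    values on the cone are known only because the cone lies in the carrier.\<close>
  have "pos_cone G \<subseteq> carrier G"
    using G.cone_submonoid by (rule submonoid.subset)
  then show ?thesis
    using assms(1,2) by (fastforce simp: preord_hom_def compose_def hom_def Pi_iff)
qed

lemma Z_trivial_iff:
  fixes G :: "'a preord_group" and H :: "'b preord_group"
  assumes "preordered_group G" and "preordered_group H" and f: "f \<in> preord_hom G H"
  shows "Z_trivial G H f \<longleftrightarrow> f ` pos_cone G \<subseteq> {\<one>\<^bsub>H\<^esub>}"
proof
  interpret G: preordered_group G by fact
  interpret H: preordered_group H by fact
  have cone: "pos_cone G \<subseteq> carrier G"
    using G.cone_submonoid by (rule submonoid.subset)
  show "f ` pos_cone G \<subseteq> {\<one>\<^bsub>H\<^esub>}" if "Z_trivial G H f"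
  proof -
    obtain Z :: "'b preord_group" and h g where Z: "Z_object Z" and h: "h \<in> preord_hom G Z"
      and g: "g \<in> preord_hom Z H" and eq: "f = compose (carrier G) g h"
      using \<open>Z_trivial G H f\<close> by (auto simp: Z_trivial_def factors_through_def)
    interpret Z: preordered_group Z using Z by (simp add: Z_object_def)
    have "g \<one>\<^bsub>Z\<^esub> = \<one>\<^bsub>H\<^esub>"
      using g by (intro hom_one) (auto simp: preord_hom_def Z.is_group H.is_group)
    then show ?thesis
      using Z h cone by (auto simp: eq Z_object_def preord_hom_def compose_def)
  qed
  show "Z_trivial G H f" if triv: "f ` pos_cone G \<subseteq> {\<one>\<^bsub>H\<^esub>}"
  proof -
    \<comment> \<open>The codomain with its cone shrunk as far as possible: \<open>f\<close> already
      lands there, and the identity map leads back to \<open>H\<close>.\<close>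
    let ?Z = "H\<lparr>pos_cone := {\<one>\<^bsub>H\<^esub>}\<rparr>"
    have one: "{\<one>\<^bsub>H\<^esub>} \<subseteq> pos_cone H"
      using submonoid.one_closed[OF H.cone_submonoid] by simp
    have "preordered_group ?Z"
      by (rule preordered_group_pos_cone_update) (auto intro!: submonoid.intro)
    then have "Z_object ?Z"
      by (simp add: Z_object_def)
    moreover have "f \<in> preord_hom G ?Z"
      using f triv by (simp add: preord_hom_pos_cone_update[OF one])
    moreover have "(\<lambda>x\<in>carrier H. x) \<in> preord_hom ?Z H"
      using one by (intro preord_hom_Id_pos_cone_update) (auto simp: H.is_group)
    moreover have "f = compose (carrier G) (\<lambda>x\<in>carrier H. x) f"
      using f by (simp add: Id_compose preord_hom_def hom_def)
    ultimately show ?thesis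
      unfolding Z_trivial_def factors_through_def by blast
  qed
qed

lemma monoid_cone_monoid:
  assumes "preordered_group G"
  shows "monoid (cone_monoid G)"
proof -
  interpret preordered_group G by fact
  interpret P: submonoid "pos_cone G" G by (rule cone_submonoid)
  show ?thesis
    by (rule monoidI) (simp_all add: cone_monoid_def m_assoc)
qed

lemma cone_map_monoid_hom:
  assumes "preordered_group G" and "preordered_group H" and "f \<in> preord_hom G H"
  shows "cone_map G f \<in> monoid_hom (cone_monoid G) (cone_monoid H)"
proof -
  interpret G: preordered_group G by fact
  interpret H: preordered_group H by fact
  interpret P: submonoid "pos_cone G" G by (rule G.cone_submonoid)
  \<comment> \<open>\<open>hom\<close> asks only for multiplicativity, while
    \<open>monoid_hom\<close> also fixes the neutral element. Cones may lack inverses, so this is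
    derived in the ambient groups.\<close>
  have "f \<one>\<^bsub>G\<^esub> = \<one>\<^bsub>H\<^esub>"
    using assms(3) by (intro hom_one) (auto simp: preord_hom_def G.is_group H.is_group)
  then show ?thesis
    using assms(3) by (auto simp: monoid_hom_def cone_monoid_def cone_map_def preord_hom_def hom_def)
qed

text \<open>Kernels of group morphisms are normal, so intersecting with one keeps the cone closed
  under conjugation.\<close>

lemma preordered_group_restrict_cone_kernel:
  assumes "preordered_group G" and "preordered_group H" and "f \<in> preord_hom G H"
  shows "preordered_group (G\<lparr>pos_cone := pos_cone G \<inter> kernel G H f\<rparr>)"
proof -
  interpret G: preordered_group G by fact
  interpret H: preordered_group H by fact
  interpret group_hom G H f
    using assms(3) by unfold_locales (simp add: preord_hom_def)
  interpret N: normal "kernel G H f" G by (rule normal_kernel)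
  interpret P: submonoid "pos_cone G" G by (rule G.cone_submonoid)
  show ?thesis
  proof (rule preordered_group_pos_cone_update)
    show "submonoid (pos_cone G \<inter> kernel G H f) G"
      using P.subset by (auto intro!: submonoid.intro)
  qed (auto simp: G.cone_conj_closed N.inv_op_closed2)
qed

lemma is_Z_kernel_restrict_cone:
  assumes G: "preordered_group G" and H: "preordered_group H" and f: "f \<in> preord_hom G H"
  shows "is_Z_kernel TYPE('x) (G\<lparr>pos_cone := pos_cone G \<inter> kernel G H f\<rparr>) G H (\<lambda>x\<in>carrier G. x) f"
    (is "is_Z_kernel _ ?K G H ?k f")
proof -
  note K = preordered_group_restrict_cone_kernel[OF assms]
  have sub: "pos_cone G \<inter> kernel G H f \<subseteq> pos_cone G" by blast
  have k: "?k \<in> preord_hom ?K G"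
    by (rule preord_hom_Id_pos_cone_update)
      (use G in \<open>auto simp: kernel_def preordered_group_def\<close>)
  \<comment> \<open>Composing with \<open>?k\<close> changes nothing, so \<alpha> is the only
    candidate for its own factorization. Uniqueness is then immediate, and existence reduces to
    \<alpha> being a morphism into \<open>?K\<close>.\<close>
  have Id: "compose (carrier X) ?k \<phi> = \<phi>" if "\<phi> \<in> preord_hom X G"
    for X :: "'x preord_group" and \<phi>
    using that by (intro Id_compose) (auto simp: preord_hom_def hom_def)
  have triv: "Z_trivial ?K H (compose (carrier ?K) f ?k)"
    unfolding Z_trivial_iff[OF K H preord_hom_compose[OF k f K]]
    by (auto simp: compose_def kernel_def)
  have lift: "\<alpha> \<in> preord_hom X ?K"
    if X: "preordered_group X" and \<alpha>: "\<alpha> \<in> preord_hom X G"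
      and "Z_trivial X H (compose (carrier X) f \<alpha>)" for X :: "'x preord_group" and \<alpha>
  proof -
    have "pos_cone X \<subseteq> carrier X"
      using X by (simp add: preordered_group.cone_submonoid submonoid.subset)
    then show ?thesis
      using that Z_trivial_iff[OF X H preord_hom_compose[OF \<alpha> f X]]
      unfolding preord_hom_pos_cone_update[OF sub]
      by (fastforce simp: compose_def kernel_def preord_hom_def hom_def)
  qed
  have "\<exists>!\<phi>. \<phi> \<in> preord_hom X ?K \<and> compose (carrier X) ?k \<phi> = \<alpha>"
    if "preordered_group X" "\<alpha> \<in> preord_hom X G"
      "Z_trivial X H (compose (carrier X) f \<alpha>)" for X :: "'x preord_group" and \<alpha>
    using lift[OF that] Id preord_hom_pos_cone_update[OF sub] by metis
  then show ?thesis
    using K k triv by (simp add: is_Z_kernel_def)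
qed

text \<open>Stated for arbitrary monoids, since positive cones need not be groups. As for the
  \<Z>-kernel, a map killed by \<open>q\<close> is its own unique lift: its values already lie in
  the set-theoretic kernel.\<close>

lemma is_monoid_kernel_kernel:
  assumes C: "monoid C" and D: "monoid D" and q: "q \<in> monoid_hom C D"
  shows "is_monoid_kernel TYPE('y) (C\<lparr>carrier := kernel C D q\<rparr>) C D (\<lambda>x\<in>kernel C D q. x) q"
    (is "is_monoid_kernel _ ?K C D ?k q")
proof -
  interpret C: monoid C by fact
  interpret D: monoid D by fact
  have K: "monoid ?K"
    using q by (intro monoidI) (auto simp: monoid_hom_def hom_def kernel_def C.m_assoc)
  have k: "?k \<in> monoid_hom ?K C"
    \<comment> \<open>Products must stay in the kernel, as the restricted identity is
      \<open>undefined\<close> outside it.\<close>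
    using q monoid.m_closed[OF K]
    by (auto simp: monoid_hom_def hom_def kernel_def)
  have zero: "compose (carrier ?K) q ?k = zero_hom ?K D"
    by (auto simp: compose_def zero_hom_def kernel_def)
  have Id: "compose (carrier X) ?k \<phi> = \<phi>" if "\<phi> \<in> monoid_hom X ?K"
    for X :: "'y monoid" and \<phi>
    using that by (intro Id_compose) (auto simp: monoid_hom_def hom_def)
  have lift: "\<alpha> \<in> monoid_hom X ?K"
    if \<alpha>: "\<alpha> \<in> monoid_hom X C" and "compose (carrier X) q \<alpha> = zero_hom X D"
    for X :: "'y monoid" and \<alpha>
  proof -
    have "q (\<alpha> x) = \<one>\<^bsub>D\<^esub>" if "x \<in> carrier X" for x
      using fun_cong[OF \<open>compose (carrier X) q \<alpha> = zero_hom X D\<close>, of x] that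
      by (simp add: compose_def zero_hom_def)
    then show ?thesis
      using \<alpha> by (auto simp: monoid_hom_def hom_def kernel_def)
  qed
  have "\<exists>!\<phi>. \<phi> \<in> monoid_hom X ?K \<and> compose (carrier X) ?k \<phi> = \<alpha>"
    if "\<alpha> \<in> monoid_hom X C" "compose (carrier X) q \<alpha> = zero_hom X D"
    for X :: "'y monoid" and \<alpha>
    using lift[OF that] Id by metis
  then show ?thesis
    using K k zero unfolding is_monoid_kernel_def by blast
qed

theorem proposition3p1:
  fixes G :: "'a preord_group" and H :: "'b preord_group" and f :: "'a \<Rightarrow> 'b"
  assumes "preordered_group G" and "preordered_group H" and "f \<in> preord_hom G H"
  shows "let K = G\<lparr>pos_cone := pos_cone G \<inter> kernel G H f\<rparr>;
             k = (\<lambda>x\<in>carrier G. x)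
         in is_Z_kernel TYPE('x) K G H k f \<and>
            cone_map K k = (\<lambda>p\<in>pos_cone G \<inter> kernel G H f. p) \<and>
            pos_cone G \<inter> kernel G H f = kernel (cone_monoid G) (cone_monoid H) (cone_map G f) \<and>
            is_monoid_kernel TYPE('y)
              (cone_monoid K) (cone_monoid G) (cone_monoid H) (cone_map K k) (cone_map G f)"
proof -
  interpret G: preordered_group G by fact
  interpret P: submonoid "pos_cone G" G by (rule G.cone_submonoid)
  let ?P = "pos_cone G \<inter> kernel G H f"
  let ?K = "G\<lparr>pos_cone := ?P\<rparr>" and ?k = "\<lambda>x\<in>carrier G. x"
  have map: "cone_map ?K ?k = (\<lambda>p\<in>?P. p)"
    using P.subset by (auto simp: cone_map_def restrict_def)
  \<comment> \<open>\<open>kernel\<close> ranges over the carrier of its source: all of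
    \<open>G\<close> on the left, only the cone on the right. Intersecting with the cone removes the
    difference.\<close>
  have ker: "?P = kernel (cone_monoid G) (cone_monoid H) (cone_map G f)"
    using P.subset by (auto simp: kernel_def cone_monoid_def cone_map_def)
  \<comment> \<open>Shrinking the cone and then taking its monoid is the same as shrinking the
    carrier of the cone monoid, which is the form that \<open>is_monoid_kernel_kernel\<close>
    yields.\<close>
  have mon: "(cone_monoid G)\<lparr>carrier := ?P\<rparr> = cone_monoid ?K"
    by (simp add: cone_monoid_def)
  have "is_monoid_kernel TYPE('y) ((cone_monoid G)\<lparr>carrier := ?P\<rparr>) (cone_monoid G) (cone_monoid H)
      (\<lambda>p\<in>?P. p) (cone_map G f)"
    unfolding ker
    by (intro is_monoid_kernel_kernel monoid_cone_monoid cone_map_monoid_hom assms)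
  then have "is_monoid_kernel TYPE('y) (cone_monoid ?K) (cone_monoid G) (cone_monoid H)
      (cone_map ?K ?k) (cone_map G f)"
    unfolding mon map .
  with is_Z_kernel_restrict_cone[OF assms] map ker show ?thesis
    unfolding Let_def by (intro conjI)
qed

end
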